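(* Every $(p,m,0)$ signed graph $S$ on a double star (that is, every signed double star all of whose edges are positive) is additively graceful.
   Context: A signed graph $S$ is a finite simple graph on $p$ vertices in which $m$ edges are specified as positive and the remaining $n$ edges are specified as negative; it is then called a $(p,m,n)$ signed graph, with sets of positive and negative edges $E^+(S)$ and $E^-(S)$. "A signed graph on $G$" means a signed graph whose underlying graph (ignoring signs) is $G$. Given two stars $K_{1,r}$ and $K_{1,s}$, each with a chosen central vertex, a double star is the graph obtained from their disjoint union by joining the two central vertices by an edge. An additively graceful labeling of a $(p,m,n)$ signed graph $S=(V,E)$ is an injective map $f:V\to\{0,1,\dots,m+\lceil\frac{n+1}{2}\rceil\}$ such that, with $f^*(uv)=f(u)+f(v)$ for $uv\in E^-(S)$ and $f^*(uv)=|f(u)-f(v)|$ for $uv\in E^+(S)$, one has $\{f^*(uv):uv\in E^-(S)\}=\{1,2,\dots,n\}$ and $\{f^*(uv):uv\in E^+(S)\}=\{1,2,\dots,m\}$. $S$ is additively graceful if it admits such a labeling. *)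

theory Defs
  imports Complex_Main
begin

text \<open>Edges of simple graphs are two-element vertex sets.\<close>

record 'v signed_graph =
  vertices :: "'v set"
  pos_edges :: "'v set set"
  neg_edges :: "'v set set"

definition simple_graph :: "'v set \<Rightarrow> 'v set set \<Rightarrow> bool" where
  "simple_graph V E \<longleftrightarrow> finite V \<and> (\<forall>e\<in>E. e \<subseteq> V \<and> card e = 2)"

definition all_edges :: "'v signed_graph \<Rightarrow> 'v set set" where
  "all_edges S = pos_edges S \<union> neg_edges S"

definition pmn_signed_graph :: "nat \<Rightarrow> nat \<Rightarrow> nat \<Rightarrow> 'v signed_graph \<Rightarrow> bool" where
  "pmn_signed_graph p m n S \<longleftrightarrow>
     simple_graph (vertices S) (all_edges S) \<and>
     pos_edges S \<inter> neg_edges S = {} \<and>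
     card (vertices S) = p \<and> card (pos_edges S) = m \<and> card (neg_edges S) = n"

definition is_star :: "nat \<Rightarrow> 'v \<Rightarrow> 'v set \<Rightarrow> 'v set set \<Rightarrow> bool" where
  "is_star r c V E \<longleftrightarrow>
     finite V \<and> c \<in> V \<and> card (V - {c}) = r \<and> E = {{c, v} | v. v \<in> V - {c}}"

text \<open>No lower bound is imposed on \<open>r\<close> and \<open>s\<close>; the degenerate stars with no leaves are
  included.\<close>

definition is_double_star :: "'v set \<Rightarrow> 'v set set \<Rightarrow> bool" where
  "is_double_star V E \<longleftrightarrow>
     (\<exists>r s c d V1 V2 E1 E2.
        is_star r c V1 E1 \<and> is_star s d V2 E2 \<and> V1 \<inter> V2 = {} \<and>
        V = V1 \<union> V2 \<and> E = E1 \<union> E2 \<union> {{c, d}})"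

definition induced_label :: "'v signed_graph \<Rightarrow> ('v \<Rightarrow> int) \<Rightarrow> 'v \<Rightarrow> 'v \<Rightarrow> int" where
  "induced_label S f u v = (if {u, v} \<in> neg_edges S then f u + f v else \<bar>f u - f v\<bar>)"

text \<open>Labels are integers, so that the difference of two labels is not truncated; the values of
  \<open>f\<close> outside the vertex set are irrelevant.\<close>

definition additively_graceful_labeling :: "'v signed_graph \<Rightarrow> ('v \<Rightarrow> int) \<Rightarrow> bool" where
  "additively_graceful_labeling S f \<longleftrightarrow>
     (let m = card (pos_edges S); n = card (neg_edges S) in
        inj_on f (vertices S) \<and>
        f ` vertices S \<subseteq> {0..int m + \<lceil>(real n + 1) / 2\<rceil>} \<and>
        {induced_label S f u v | u v. {u, v} \<in> neg_edges S} = {1..int n} \<and>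
        {induced_label S f u v | u v. {u, v} \<in> pos_edges S} = {1..int m})"

definition additively_graceful :: "'v signed_graph \<Rightarrow> bool" where
  "additively_graceful S \<longleftrightarrow> (\<exists>f. additively_graceful_labeling S f)"

end

theory Submission
  imports Defs
begin

text \<open>Let the double star have centres \<open>c\<close>, \<open>d\<close> with leaf sets \<open>A\<close>, \<open>B\<close> of sizes \<open>r\<close>, \<open>s\<close>, so that
  there are \<open>m = r + s + 1\<close> edges. Without negative edges, an additively graceful labelling is
  just an ordinary graceful labelling, and a double star is a caterpillar, for which the usual
  zigzag labelling works. Split the vertices into the bipartition classes \<open>{c} \<union> B\<close> and
  \<open>A \<union> {d}\<close>; the first class gets the low labels, with \<open>0\<close> on \<open>c\<close> and \<open>1, \<dots>, s\<close> on \<open>B\<close>, and the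
  second gets the high labels, with \<open>s + 1\<close> on \<open>d\<close> and \<open>s + 2, \<dots>, m\<close> on \<open>A\<close>. The edges at \<open>c\<close> then
  have labels \<open>s + 1, \<dots>, m\<close> (the smallest on the joining edge) and the edges from \<open>d\<close> to \<open>B\<close> have
  labels \<open>s, \<dots>, 1\<close>. The existence of such a labelling is \<open>zigzag_labeling_exists\<close>; the count of the
  edges, which ties the labels to the parameter \<open>m\<close>, is \<open>card_double_star_edges\<close>.\<close>

lemma ex_image_eq_of_card:
  assumes "finite A" "finite T" "card A = card T"
  obtains g where "g ` A = T"
  using finite_same_card_bij[OF assms] unfolding bij_betw_def by blast

text \<open>Injectivity is a consequence of counting: the prescribed values fill \<open>{0..r + s + 1}\<close>, which
  has as many elements as there are vertices.\<close>

lemma zigzag_labeling_exists: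
  fixes c d :: 'v
  assumes "finite A" "finite B" "c \<noteq> d" "A \<inter> B = {}"
    and "c \<notin> A" "d \<notin> A" "c \<notin> B" "d \<notin> B"
  obtains f :: "'v \<Rightarrow> int"
  where "f c = 0" "f d = int (card B) + 1"
    and "f ` A = {int (card B) + 2..int (card A + card B) + 1}"
    and "f ` B = {1..int (card B)}"
    and "inj_on f (insert c (insert d (A \<union> B)))"
    and "f ` insert c (insert d (A \<union> B)) = {0..int (card A + card B) + 1}"
proof -
  let ?V = "insert c (insert d (A \<union> B))"
  obtain g where g: "g ` A = {int (card B) + 2..int (card A + card B) + 1}"
    using ex_image_eq_of_card[OF assms(1), of "{int (card B) + 2..int (card A + card B) + 1}"]
    by auto
  obtain h where h: "h ` B = {1..int (card B)}"
    using ex_image_eq_of_card[OF assms(2), of "{1..int (card B)}"] by auto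
  define f where "f v = (if v = c then 0 else if v = d then int (card B) + 1
      else if v \<in> A then g v else h v)" for v
  have fc: "f c = 0" and fd: "f d = int (card B) + 1"
    using assms by (auto simp: f_def)
  have fA: "f ` A = g ` A"
    using assms by (intro image_cong) (auto simp: f_def)
  have fB: "f ` B = h ` B"
    using assms by (intro image_cong) (auto simp: f_def)
  have img: "f ` ?V = {0..int (card A + card B) + 1}"
    unfolding image_insert image_Un fc fd fA fB g h by auto
  have "card ?V = card A + card B + 2"
    using assms by (simp add: card_Un_disjoint)
  then have "card (f ` ?V) = card ?V"
    unfolding img by simp
  then have "inj_on f ?V"
    using assms by (intro eq_card_imp_inj_on) auto
  then show thesis
    using that fc fd fA fB g h img by simp
qed

lemma card_star_edges:
  assumes "c \<notin> A"
  shows "card ((\<lambda>v. {c, v}) ` A) = card A"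
  using assms by (intro card_image) (auto simp: inj_on_def doubleton_eq_iff)

text \<open>Counting the joining edge among the edges at \<open>c\<close> leaves just two families of edges, which
  are disjoint because an edge from \<open>d\<close> to \<open>B\<close> does not contain \<open>c\<close>.\<close>

lemma card_double_star_edges:
  assumes "finite A" "finite B" "c \<noteq> d" "c \<notin> A" "d \<notin> A" "c \<notin> B" "d \<notin> B"
  shows "card ((\<lambda>v. {c, v}) ` insert d A \<union> (\<lambda>v. {d, v}) ` B) = card A + card B + 1"
proof -
  have "(\<lambda>v. {c, v}) ` insert d A \<inter> (\<lambda>v. {d, v}) ` B = {}"
    using assms by auto
  then show ?thesis
    using assms card_star_edges[of c "insert d A"] card_star_edges[of d B]
    by (subst card_Un_disjoint) auto
qed

text \<open>The set of edge labels ranges over ordered pairs of endpoints; by symmetry of the absolute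
  difference, each edge of a star may be read from its centre.\<close>

lemma edge_differences_two_stars:
  fixes f :: "'v \<Rightarrow> int"
  shows "{\<bar>f u - f v\<bar> | u v. {u, v} \<in> (\<lambda>v. {c, v}) ` X \<union> (\<lambda>v. {d, v}) ` Y} =
    (\<lambda>x. \<bar>f c - x\<bar>) ` f ` X \<union> (\<lambda>x. \<bar>f d - x\<bar>) ` f ` Y"
    (is "?L = ?R")
proof
  show "?L \<subseteq> ?R"
    by (auto simp: doubleton_eq_iff image_iff abs_minus_commute)
  show "?R \<subseteq> ?L"
    by blast
qed

lemma image_abs_diff_from_above:
  fixes k :: int
  assumes "b \<le> k"
  shows "(\<lambda>x. \<bar>k - x\<bar>) ` {a..b} = {k - b..k - a}"
proof -
  have "(\<lambda>x. \<bar>k - x\<bar>) ` {a..b} = (\<lambda>x. k - x) ` {a..b}"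
    using assms by (intro image_cong) auto
  then show ?thesis by simp
qed

lemma is_double_star_edges:
  assumes "is_double_star V E"
  obtains c d A B where "finite A" "finite B" "c \<noteq> d" "A \<inter> B = {}"
    and "c \<notin> A" "d \<notin> A" "c \<notin> B" "d \<notin> B"
    and "V = insert c (insert d (A \<union> B))"
    and "E = (\<lambda>v. {c, v}) ` insert d A \<union> (\<lambda>v. {d, v}) ` B"
proof -
  obtain r s c d V1 V2 E1 E2 where
    *: "is_star r c V1 E1" "is_star s d V2 E2" "V1 \<inter> V2 = {}"
      "V = V1 \<union> V2" "E = E1 \<union> E2 \<union> {{c, d}}"
    using assms unfolding is_double_star_def by blast
  show thesis
    by (rule that[of "V1 - {c}" "V2 - {d}" c d]) (use * in \<open>auto simp: is_star_def\<close>)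
qed

theorem theorem3p1:
  fixes S :: "'v signed_graph" and p m :: nat
  assumes "pmn_signed_graph p m 0 S"
    and "is_double_star (vertices S) (all_edges S)"
  shows "additively_graceful S"
proof -
  \<comment> \<open>An infinite set also has \<open>card\<close> equal to \<open>0\<close>; finiteness comes from the vertex set.\<close>
  have "neg_edges S \<subseteq> Pow (vertices S)" "finite (vertices S)"
    using assms(1) unfolding pmn_signed_graph_def simple_graph_def all_edges_def by auto
  then have "finite (neg_edges S)"
    by (meson finite_Pow_iff finite_subset)
  then have neg: "neg_edges S = {}"
    using assms(1) unfolding pmn_signed_graph_def by simp
  then have all: "all_edges S = pos_edges S"
    by (simp add: all_edges_def)
  obtain c d A B where
    AB: "finite A" "finite B" "c \<noteq> d" "A \<inter> B = {}" "c \<notin> A" "d \<notin> A" "c \<notin> B" "d \<notin> B"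
    and V: "vertices S = insert c (insert d (A \<union> B))"
    and E: "pos_edges S = (\<lambda>v. {c, v}) ` insert d A \<union> (\<lambda>v. {d, v}) ` B"
    using is_double_star_edges[OF assms(2)] unfolding all by metis
  obtain f :: "'v \<Rightarrow> int" where
    f: "f c = 0" "f d = int (card B) + 1"
      "f ` A = {int (card B) + 2..int (card A + card B) + 1}" "f ` B = {1..int (card B)}"
    and inj: "inj_on f (vertices S)"
    and img: "f ` vertices S = {0..int (card A + card B) + 1}"
    using zigzag_labeling_exists[OF AB] unfolding V by metis
  have m: "card (pos_edges S) = card A + card B + 1"
    unfolding E using AB by (intro card_double_star_edges) auto
  have "{induced_label S f u v | u v. {u, v} \<in> pos_edges S} =
      {\<bar>f u - f v\<bar> | u v. {u, v} \<in> pos_edges S}"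
    by (simp add: induced_label_def neg)
  also have "\<dots> = (\<lambda>x. \<bar>f c - x\<bar>) ` f ` insert d A \<union> (\<lambda>x. \<bar>f d - x\<bar>) ` f ` B"
    unfolding E by (rule edge_differences_two_stars)
  also have "f ` insert d A = {int (card B) + 1..int (card A + card B) + 1}"
    unfolding image_insert f by auto
  also have "(\<lambda>x. \<bar>f c - x\<bar>) ` \<dots> = \<dots>"
    unfolding f by force
  also have "(\<lambda>x. \<bar>f d - x\<bar>) ` f ` B = {1..int (card B)}"
    unfolding f by (subst image_abs_diff_from_above) auto
  also have "{int (card B) + 1..int (card A + card B) + 1} \<union> {1..int (card B)}
      = {1..int (card (pos_edges S))}"
    unfolding m by auto
  finally have "{induced_label S f u v | u v. {u, v} \<in> pos_edges S} =
      {1..int (card (pos_edges S))}" .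
  then have "additively_graceful_labeling S f"
    unfolding additively_graceful_labeling_def Let_def
    using inj by (simp add: neg img m)
  then show ?thesis
    unfolding additively_graceful_def by blast
qed

end
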